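(* Let $\mathcal{H}_1,\mathcal{H}_2$ be complex separable Hilbert spaces and let $A:\operatorname{dom}(A)\subseteq\mathcal{H}_1\to\mathcal{H}_2$ be a densely defined, closed, linear operator with $\ker(A)=\{0\}$ and $\inf(\sigma(A^*A))=0$. Then $$\overline{A^*A_0}=A^*\,\overline{A_0}.$$
   Context: $\mathcal{H}_A$ is the Hilbert space completion of $\operatorname{dom}(A)$ with respect to the scalar product $(f,g)_A=(Af,Ag)_{\mathcal{H}_2}$; $\operatorname{dom}(A)$ is regarded as a dense subspace of $\mathcal{H}_A$. $\mathcal{K}_A=\overline{\operatorname{ran}(A)}\subseteq\mathcal{H}_2$. $A_0:\mathcal{H}_A\supseteq\operatorname{dom}(A)\to\mathcal{K}_A$ is the map $f\mapsto Af$, a densely defined isometric operator whose closure $\overline{A_0}$ is a unitary operator from $\mathcal{H}_A$ onto $\mathcal{K}_A$. The products $A^*A_0$ and $A^*\overline{A_0}$ are operators from $\mathcal{H}_A$ to $\mathcal{H}_1$ with their natural (maximal) domains, $\operatorname{dom}(A^*A_0)=\{f\in\operatorname{dom}(A): Af\in\operatorname{dom}(A^* )\}$ and $\operatorname{dom}(A^*\overline{A_0})=\{f\in\mathcal{H}_A:\overline{A_0}f\in\operatorname{dom}(A^* )\}$. A bar over an operator denotes its closure. *)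

theory Defs
  imports "HOL-Analysis.Analysis"
begin

text \<open>Complex inner products are linear in the first argument.  Building on \<^class>\<open>real_inner\<close>
  makes the norm and the topology those of the library; the real structure is the
  restriction of scalars of the complex one.\<close>

class complex_inner = real_inner +
  fixes scaleC :: "complex \<Rightarrow> 'a \<Rightarrow> 'a" (infixr "*\<^sub>C" 75)
    and cinner :: "'a \<Rightarrow> 'a \<Rightarrow> complex"
  assumes scaleC_add_right: "c *\<^sub>C (x + y) = c *\<^sub>C x + c *\<^sub>C y"
    and scaleC_add_left: "(c + d) *\<^sub>C x = c *\<^sub>C x + d *\<^sub>C x"
    and scaleC_scaleC: "c *\<^sub>C d *\<^sub>C x = (c * d) *\<^sub>C x"
    and scaleR_eq_scaleC: "r *\<^sub>R x = complex_of_real r *\<^sub>C x"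
    and cinner_commute: "cinner x y = cnj (cinner y x)"
    and cinner_add_left: "cinner (x + y) z = cinner x z + cinner y z"
    and cinner_scaleC_left: "cinner (c *\<^sub>C x) y = c * cinner x y"
    and inner_eq_Re_cinner: "inner x y = Re (cinner x y)"

class complex_hilbert_space = complex_inner + complete_space

instantiation complex :: complex_hilbert_space
begin

definition scaleC_complex :: "complex \<Rightarrow> complex \<Rightarrow> complex"
  where "scaleC_complex c x = c * x"

definition cinner_complex :: "complex \<Rightarrow> complex \<Rightarrow> complex"
  where "cinner_complex x y = x * cnj y"

instance
  by standard
    (simp_all add: scaleC_complex_def cinner_complex_def inner_complex_def algebra_simps
      scaleR_conv_of_real)

end

text \<open>An unbounded operator from \<open>'a\<close> to \<open>'b\<close> is identified with its graph, of type
  \<open>('a \<times> 'b) set\<close>.  Thus \<^const>\<open>Domain\<close> and \<^const>\<open>Range\<close> are its domain and range, equality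
  of graphs is equality of operators (domains included), an operator is closed iff its graph
  is \<^const>\<open>closed\<close>, and the graph of the closure of a closable operator is the
  \<^const>\<open>closure\<close> of its graph.\<close>

definition linear_operator ::
    "('a::complex_inner \<times> 'b::complex_inner) set \<Rightarrow> bool"
  where "linear_operator A \<longleftrightarrow>
    single_valued A \<and> (0, 0) \<in> A \<and>
    (\<forall>f g h k. (f, h) \<in> A \<longrightarrow> (g, k) \<in> A \<longrightarrow> (f + g, h + k) \<in> A) \<and>
    (\<forall>c f h. (f, h) \<in> A \<longrightarrow> (c *\<^sub>C f, c *\<^sub>C h) \<in> A)"

definition op_apply :: "('a \<times> 'b) set \<Rightarrow> 'a \<Rightarrow> 'b"
  where "op_apply A f = (THE h. (f, h) \<in> A)"

definition densely_defined :: "('a::topological_space \<times> 'b) set \<Rightarrow> bool"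
  where "densely_defined A \<longleftrightarrow> closure (Domain A) = UNIV"

definition op_kernel :: "('a \<times> 'b::zero) set \<Rightarrow> 'a set"
  where "op_kernel A = {f. (f, 0) \<in> A}"

text \<open>The relational composition of the graphs gives the product \<open>S T\<close> on its maximal domain
  \<open>{f \<in> dom T. T f \<in> dom S}\<close>; \<^const>\<open>relcomp\<close> lists the factor applied first on the left.\<close>

abbreviation op_comp :: "('b \<times> 'c) set \<Rightarrow> ('a \<times> 'b) set \<Rightarrow> ('a \<times> 'c) set"
    (infixr "\<circ>\<^sub>o" 75)
  where "S \<circ>\<^sub>o T \<equiv> T O S"

text \<open>\<open>g \<in> dom A\<^sup>*\<close> and \<open>A\<^sup>* g = h\<close> iff \<open>(A f, g) = (f, h)\<close> for all \<open>f \<in> dom A\<close>.  This is single-valued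
  when \<open>A\<close> is densely defined, the only case in which it is used.\<close>

definition op_adjoint ::
    "('a::complex_inner \<times> 'b::complex_inner) set \<Rightarrow> ('b \<times> 'a) set"
  where "op_adjoint A = {(g, h). \<forall>(f, k) \<in> A. cinner k g = cinner f h}"

definition op_shift :: "('a::complex_inner \<times> 'a) set \<Rightarrow> complex \<Rightarrow> ('a \<times> 'a) set"
  where "op_shift T z = {(f, k - z *\<^sub>C f) |f k. (f, k) \<in> T}"

text \<open>\<open>z\<close> is in the resolvent set iff \<open>T - z\<close> is a bijection from its domain onto the whole space
  with bounded inverse.\<close>

definition resolvent_set :: "('a::complex_inner \<times> 'a) set \<Rightarrow> complex set"
  where "resolvent_set T = {z.
    single_valued ((op_shift T z)\<inverse>) \<and> Range (op_shift T z) = UNIV \<and>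
    (\<exists>C. \<forall>(f, k) \<in> op_shift T z. norm f \<le> C * norm k)}"

definition spectrum :: "('a::complex_inner \<times> 'a) set \<Rightarrow> complex set"
  where "spectrum T = - resolvent_set T"

text \<open>The spectrum of the self-adjoint operator \<open>A\<^sup>* A\<close> is real, so that its infimum is that of the
  corresponding set of reals.  It is taken in \<^typ>\<open>ereal\<close>, where the infimum of the empty set is
  \<open>\<infinity>\<close> and that of a set unbounded below is \<open>-\<infinity>\<close>.\<close>

definition spectrum_inf :: "('a::complex_inner \<times> 'a) set \<Rightarrow> ereal"
  where "spectrum_inf T = Inf {ereal r |r. complex_of_real r \<in> spectrum T}"

text \<open>\<open>\<iota>\<close> exhibits the Hilbert space \<open>'h\<close> as the completion of the linear subspace \<open>D\<close> with
  respect to the scalar product \<open>s\<close> on \<open>D\<close>.  Values of \<open>\<iota>\<close> and \<open>s\<close> outside \<open>D\<close> are irrelevant.\<close>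

definition hilbert_completion ::
    "'a::complex_inner set \<Rightarrow> ('a \<Rightarrow> 'a \<Rightarrow> complex) \<Rightarrow> ('a \<Rightarrow> 'h::complex_hilbert_space) \<Rightarrow> bool"
  where "hilbert_completion D s \<iota> \<longleftrightarrow>
    (\<forall>f\<in>D. \<forall>g\<in>D. \<iota> (f + g) = \<iota> f + \<iota> g) \<and>
    (\<forall>c. \<forall>f\<in>D. \<iota> (c *\<^sub>C f) = c *\<^sub>C \<iota> f) \<and>
    (\<forall>f\<in>D. \<forall>g\<in>D. cinner (\<iota> f) (\<iota> g) = s f g) \<and>
    closure (\<iota> ` D) = UNIV"

definition op_form :: "('a \<times> 'b::complex_inner) set \<Rightarrow> 'a \<Rightarrow> 'a \<Rightarrow> complex"
  where "op_form A f g = cinner (op_apply A f) (op_apply A g)"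

text \<open>\<open>A\<^sub>0\<close>: the operator \<open>A\<close> with its domain viewed inside a completion via \<open>\<iota>\<close>.  Its natural
  target is the closed subspace \<open>closure (Range A)\<close>; taking the ambient space as target does
  not change the closure, by the lemma below.\<close>

definition transported_operator :: "('a \<Rightarrow> 'h) \<Rightarrow> ('a \<times> 'b) set \<Rightarrow> ('h \<times> 'b) set"
  where "transported_operator \<iota> A = {(\<iota> f, k) |f k. (f, k) \<in> A}"

lemma closure_transported_operator_subset:
  fixes A :: "('a \<times> 'b::topological_space) set" and \<iota> :: "'a \<Rightarrow> 'h::topological_space"
  shows "closure (transported_operator \<iota> A) \<subseteq> UNIV \<times> closure (Range A)"
  by (rule closure_minimal) (auto simp: transported_operator_def closed_Times
      intro!: closure_subset[THEN subsetD])

end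

theory Submission
  imports Defs
begin

text \<open>\<open>A\<^sub>0\<close> is isometric and \<open>A\<^sup>*\<close> is closed, so the product of \<open>A\<^sup>*\<close> with the closure of \<open>A\<^sub>0\<close> is
  closed, which gives one inclusion.  For the other one, the isometry reduces the claim to the density of
  \<open>M = {(A f, A\<^sup>* A f)}\<close> in the graph of \<open>A\<^sup>*\<close> restricted to the closure of the range of \<open>A\<close>.
  If an element \<open>(g, h)\<close> of that graph is orthogonal to \<open>M\<close>, then
  \<open>0 = (A f, g) + (A\<^sup>* A f, h) = (f + A\<^sup>* A f, h)\<close> for all \<open>f\<close>; since \<open>1 + A\<^sup>* A\<close> is onto
  (von Neumann: project \<open>(u, 0)\<close> onto the graph of \<open>A\<close>), \<open>h = 0\<close>.  So \<open>g\<close> is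
  orthogonal to the range of \<open>A\<close>, and \<open>g = 0\<close>.  Since the graphs are complex subspaces, it is
  enough to work with the real inner products throughout.\<close>

text \<open>A sequence in \<open>S\<close> minimising the distance to \<open>x\<close> is Cauchy by
  the parallelogram identity, and minimality at its limit forces orthogonality. Working over the
  reals lets this apply to graphs, whose pairs carry the real inner product of the product
  space.\<close>

lemma closed_subspace_projection:
  fixes S :: "'a::{real_inner, complete_space} set" and x :: 'a
  assumes S: "subspace S" and cl: "closed S"
  obtains y where "y \<in> S" "\<And>s. s \<in> S \<Longrightarrow> inner (x - y) s = 0"
proof -
  define D where "D = (INF s\<in>S. (norm (x - s))\<^sup>2)"
  have ne: "S \<noteq> {}" using subspace_0[OF S] by blast
  have bdd: "bdd_below ((\<lambda>s. (norm (x - s))\<^sup>2) ` S)"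
    by (rule bdd_belowI[of _ 0]) auto
  have lower: "D \<le> (norm (x - s))\<^sup>2" if "s \<in> S" for s
    unfolding D_def by (rule cINF_lower[OF bdd that])
  have "\<exists>s\<in>S. (norm (x - s))\<^sup>2 < D + inverse (real (Suc n))" for n
    using cINF_less_iff[OF ne bdd, of "D + inverse (real (Suc n))"]
    by (simp add: D_def[symmetric])
  then obtain u where uS: "\<And>n. u n \<in> S"
    and u: "\<And>n. (norm (x - u n))\<^sup>2 < D + inverse (real (Suc n))"
    by metis
  have parallelogram: "(norm (u m - u n))\<^sup>2 \<le> 2 * inverse (real (Suc m)) + 2 * inverse (real (Suc n))"
    for m n
  proof -
    \<comment> \<open>The midpoint stays in \<open>S\<close>, so its squared distance to
      \<open>x\<close> is at least \<open>D\<close>; the parallelogram identity then leaves only the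
      two error terms.\<close>
    let ?c = "(1/2) *\<^sub>R (u m + u n)"
    have "D \<le> (norm (x - ?c))\<^sup>2"
      by (intro lower subspace_scale[OF S] subspace_add[OF S] uS)
    moreover have "(norm (u m - u n))\<^sup>2 + 4 * (norm (x - ?c))\<^sup>2
        = 2 * (norm (x - u m))\<^sup>2 + 2 * (norm (x - u n))\<^sup>2"
      by (simp add: power2_norm_eq_inner inner_simps inner_commute algebra_simps)
    ultimately show ?thesis using u[of m] u[of n] by linarith
  qed
  have "Cauchy u"
  proof (rule metric_CauchyI)
    fix e :: real assume "0 < e"
    \<comment> \<open>Each error enters the parallelogram bound with factor 2, so two errors below a
      quarter of the square of \<open>e\<close> suffice.\<close>
    then have "0 < e\<^sup>2 / 4" by simp
    then obtain N where N: "inverse (real (Suc N)) < e\<^sup>2 / 4" using reals_Archimedean by blast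
    have "dist (u m) (u n) < e" if "m \<ge> N" "n \<ge> N" for m n
    proof -
      have "inverse (real (Suc m)) \<le> inverse (real (Suc N))"
        "inverse (real (Suc n)) \<le> inverse (real (Suc N))"
        using that by (simp_all add: le_imp_inverse_le)
      then have "(norm (u m - u n))\<^sup>2 < e\<^sup>2" using parallelogram[of m n] N by linarith
      then show ?thesis using \<open>0 < e\<close> by (simp add: dist_norm power_less_imp_less_base)
    qed
    then show "\<exists>M. \<forall>m\<ge>M. \<forall>n\<ge>M. dist (u m) (u n) < e" by blast
  qed
  then obtain y where y: "u \<longlonglongrightarrow> y" using Cauchy_convergent convergent_def by blast
  have yS: "y \<in> S" using closed_sequentially[OF cl] uS y by blast
  have "(\<lambda>n. (norm (x - u n))\<^sup>2) \<longlonglongrightarrow> (norm (x - y))\<^sup>2"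
    by (intro tendsto_intros y)
  moreover have "(\<lambda>n. D + inverse (real (Suc n))) \<longlonglongrightarrow> D + 0"
    by (intro tendsto_intros LIMSEQ_inverse_real_of_nat)
  ultimately have min: "(norm (x - y))\<^sup>2 \<le> D"
    using LIMSEQ_le u less_imp_le by (metis (no_types, lifting) add.right_neutral)
  have "inner (x - y) s = 0" if s: "s \<in> S" for s
  proof (rule ccontr)
    assume nz: "inner (x - y) s \<noteq> 0"
    \<comment> \<open>This \<open>t\<close> minimises the squared distance from \<open>x\<close> to
      \<open>y + t s\<close>; a nonzero inner product would push it strictly below the
      minimum.\<close>
    define t where "t = inner (x - y) s / inner s s"
    have ss: "inner s s > 0" using nz by (cases "s = 0") auto
    have "y + t *\<^sub>R s \<in> S" using S s yS by (simp add: subspace_add subspace_scale)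
    then have "(norm (x - y))\<^sup>2 \<le> (norm (x - (y + t *\<^sub>R s)))\<^sup>2" using lower min order_trans by blast
    also have "\<dots> = (norm (x - y))\<^sup>2 - 2 * t * inner (x - y) s + t\<^sup>2 * inner s s"
      unfolding power2_norm_eq_inner diff_diff_add[symmetric]
      by (simp add: inner_diff_left inner_diff_right inner_commute power2_eq_square algebra_simps)
    also have "\<dots> = (norm (x - y))\<^sup>2 - (inner (x - y) s)\<^sup>2 / inner s s"
      using ss by (simp add: t_def power2_eq_square divide_simps)
    finally show False using ss nz
      by (smt (verit) divide_pos_pos zero_less_power2)
  qed
  then show ?thesis using that yS by blast
qed

lemma subspace_closure:
  fixes S :: "'a::real_normed_vector set"
  assumes S: "subspace S"
  shows "subspace (closure S)"
proof (rule subspaceI)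
  show "0 \<in> closure S" using subspace_0[OF S] closure_subset by blast
  show "x + y \<in> closure S" if xy: "x \<in> closure S" "y \<in> closure S" for x y
  proof -
    obtain u v where "\<And>n. u n \<in> S" "u \<longlonglongrightarrow> x" "\<And>n. v n \<in> S" "v \<longlonglongrightarrow> y"
      using xy unfolding closure_sequential by blast
    then show ?thesis unfolding closure_sequential
      by (intro exI[of _ "\<lambda>n. u n + v n"]) (simp add: subspace_add[OF S] tendsto_add)
  qed
  show "c *\<^sub>R x \<in> closure S" if "x \<in> closure S" for c x
  proof -
    obtain u where "\<And>n. u n \<in> S" "u \<longlonglongrightarrow> x"
      using \<open>x \<in> closure S\<close> unfolding closure_sequential by blast
    then show ?thesis unfolding closure_sequential
      by (intro exI[of _ "\<lambda>n. c *\<^sub>R u n"]) (simp add: subspace_scale[OF S] tendsto_scaleR)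
  qed
qed

text \<open>Projecting \<open>x\<close> onto \<open>closure S\<close> leaves a remainder that lies
  in \<open>T\<close> and is orthogonal to \<open>S\<close>. Density thus becomes triviality of the
  orthogonal complement of \<open>S\<close> within \<open>T\<close>.\<close>

lemma closure_subspaceI:
  fixes S T :: "'a::{real_inner, complete_space} set"
  assumes S: "subspace S" and T: "subspace T" and "S \<subseteq> T" "closed T"
    and trivial: "\<And>x. x \<in> T \<Longrightarrow> (\<And>s. s \<in> S \<Longrightarrow> inner x s = 0) \<Longrightarrow> x = 0"
  shows "closure S = T"
proof
  show sub: "closure S \<subseteq> T" using assms(3,4) by (rule closure_minimal)
  show "T \<subseteq> closure S"
  proof
    fix x assume "x \<in> T"
    obtain y where y: "y \<in> closure S" "\<And>s. s \<in> closure S \<Longrightarrow> inner (x - y) s = 0"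
      using closed_subspace_projection[OF subspace_closure[OF S] closed_closure] by metis
    have "x - y = 0"
      using \<open>x \<in> T\<close> y sub closure_subset[of S] T by (intro trivial) (auto intro: subspace_diff)
    then show "x \<in> closure S" using y by simp
  qed
qed

lemma subspace_linear_operator: "linear_operator A \<Longrightarrow> subspace A"
  unfolding linear_operator_def subspace_def
  by (auto simp: zero_prod_def scaleR_eq_scaleC)

text \<open>Testing the real identity also on \<open>\<i> *\<^sub>C f\<close> recovers the imaginary
  part of the complex one. Hence the adjoint can be handled with the real inner product
  alone.\<close>

lemma op_adjoint_real:
  assumes "linear_operator A"
  shows "op_adjoint A = {(g, h). \<forall>(f, k) \<in> A. inner k g = inner f h}"
proof -
  have "cinner k g = cinner f h"
    if orth: "\<forall>(f, k)\<in>A. inner k g = inner f h" and fk: "(f, k) \<in> A" for f k g h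
  proof -
    have "(\<i> *\<^sub>C f, \<i> *\<^sub>C k) \<in> A" using assms fk unfolding linear_operator_def by blast
    then have "inner (\<i> *\<^sub>C k) g = inner (\<i> *\<^sub>C f) h" "inner k g = inner f h"
      using orth fk by blast+
    then show ?thesis by (simp add: inner_eq_Re_cinner cinner_scaleC_left complex_eq_iff)
  qed
  then show ?thesis
    unfolding op_adjoint_def by (fastforce simp: inner_eq_Re_cinner)
qed

lemma subspace_op_adjoint:
  assumes "linear_operator A"
  shows "subspace (op_adjoint A)"
proof -
  have "op_adjoint A = {q. \<forall>p\<in>A. inner (snd p) (fst q) = inner (fst p) (snd q)}"
    unfolding op_adjoint_real[OF assms] by fastforce
  then show ?thesis by (simp add: subspace_def inner_add_right)
qed

lemma closed_op_adjoint:
  assumes "linear_operator A"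
  shows "closed (op_adjoint A)"
proof -
  have "op_adjoint A = (\<Inter>p\<in>A. {q. inner (snd p) (fst q) = inner (fst p) (snd q)})"
    unfolding op_adjoint_real[OF assms] by fastforce
  then show ?thesis
    by (auto intro!: closed_INT closed_Collect_eq continuous_intros)
qed

lemma one_plus_adjoint_comp_surj:
  fixes A :: "('a::complex_hilbert_space \<times> 'b::complex_hilbert_space) set"
  assumes "linear_operator A" "closed A"
  obtains f k l where "(f, k) \<in> A" "(k, l) \<in> op_adjoint A" "f + l = u"
proof -
  obtain y where y: "y \<in> A" "\<And>s. s \<in> A \<Longrightarrow> inner ((u, 0) - y) s = 0"
    using closed_subspace_projection[OF subspace_linear_operator[OF assms(1)] assms(2)] by metis
  obtain f k where fk: "y = (f, k)" by force
  \<comment> \<open>The residual is \<open>(u - f, - k)\<close>; its orthogonality to every pair of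
    the graph is exactly the defining identity of the adjoint.\<close>
  have "(k, u - f) \<in> op_adjoint A"
    unfolding op_adjoint_real[OF assms(1)]
    using y(2) by (force simp: fk inner_commute)
  then show ?thesis using that[of f k "u - f"] y(1) fk by simp
qed

text \<open>The set under the closure on the left is \<open>M\<close> from the idea above: its pairs
  are \<open>(k, l)\<close> with \<open>k\<close> a value \<open>A f\<close> in the domain of the
  adjoint. So these \<open>k\<close> form a core of the adjoint restricted to
  \<open>closure (Range A)\<close>.\<close>

lemma closure_adjoint_range_core:
  fixes A :: "('a::complex_hilbert_space \<times> 'b::complex_hilbert_space) set"
  assumes A: "linear_operator A" "closed A"
  shows "closure (op_adjoint A \<inter> Range A \<times> UNIV) = op_adjoint A \<inter> closure (Range A) \<times> UNIV"
proof (rule closure_subspaceI)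
  have "Range A = snd ` A" by force
  then have range: "subspace (Range A)"
    using linear_subspace_image[OF linear_snd subspace_linear_operator[OF A(1)]] by simp
  show "subspace (op_adjoint A \<inter> Range A \<times> UNIV)"
    "subspace (op_adjoint A \<inter> closure (Range A) \<times> UNIV)"
    by (intro subspace_inter subspace_op_adjoint[OF A(1)] subspace_Times
        subspace_closure range subspace_UNIV)+
  show "op_adjoint A \<inter> Range A \<times> UNIV \<subseteq> op_adjoint A \<inter> closure (Range A) \<times> UNIV"
    using closure_subset by fastforce
  show "closed (op_adjoint A \<inter> closure (Range A) \<times> UNIV)"
    by (intro closed_Int closed_op_adjoint[OF A(1)] closed_Times) auto
  fix x assume x: "x \<in> op_adjoint A \<inter> closure (Range A) \<times> UNIV"
    and orth: "\<And>s. s \<in> op_adjoint A \<inter> Range A \<times> UNIV \<Longrightarrow> inner x s = 0"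
  obtain g h where gh: "x = (g, h)" by force
  have adj: "inner k g = inner f h" if "(f, k) \<in> A" for f k
    using x that unfolding op_adjoint_real[OF A(1)] gh by blast
  obtain f k l where fkl: "(f, k) \<in> A" "(k, l) \<in> op_adjoint A" "f + l = h"
    using one_plus_adjoint_comp_surj[OF A] by metis
  \<comment> \<open>With \<open>h = f + l\<close>, the adjoint relation trades
    \<open>inner f h\<close> for \<open>inner k g\<close>, which produces the inner product of
    \<open>(g, h)\<close> with \<open>(k, l)\<close>.\<close>
  have "inner h h = inner g k + inner h l"
    using adj[OF fkl(1)] by (simp add: fkl(3)[symmetric] inner_simps inner_commute)
  also have "\<dots> = 0" using orth[of "(k, l)"] fkl(1,2) gh by auto
  finally have h: "h = 0" by simp
  \<comment> \<open>The closure contains \<open>g\<close> itself, so \<open>inner g g = 0\<close>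
    follows.\<close>
  have "closure (Range A) \<subseteq> {k. inner k g = 0}"
    by (rule closure_minimal)
      (use adj h in \<open>auto intro!: closed_Collect_eq continuous_intros\<close>)
  then have "g = 0" using x gh by force
  then show "x = 0" by (simp add: gh h zero_prod_def)
qed

text \<open>The scalar product of the completion is the form of \<open>A\<close>, evaluated here at
  a difference. Convergence can then be passed between the two components of pairs in the
  graph.\<close>

lemma transported_operator_isometric:
  assumes A: "linear_operator A" and compl: "hilbert_completion (Domain A) (op_form A) \<iota>"
    and "(x, g) \<in> transported_operator \<iota> A" "(x', g') \<in> transported_operator \<iota> A"
  shows "dist x x' = dist g g'"
proof -
  obtain f f' where f: "(f, g) \<in> A" "x = \<iota> f" and f': "(f', g') \<in> A" "x' = \<iota> f'"
    using assms(3,4) unfolding transported_operator_def by blast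
  \<comment> \<open>Only sums and complex multiples within \<open>Domain A\<close> are known to be
    respected by \<iota>, so a difference is written with these.\<close>
  have minus: "v - w = v + (-1) *\<^sub>C w" for v w :: "'z::complex_inner"
    using scaleR_eq_scaleC[of "-1" w] by simp
  have mem: "(f - f', g - g') \<in> A"
    using subspace_diff[OF subspace_linear_operator[OF A] f(1) f'(1)] by simp
  have dom: "f \<in> Domain A" "f' \<in> Domain A" "(-1) *\<^sub>C f' \<in> Domain A" "f - f' \<in> Domain A"
    using f f' mem A unfolding linear_operator_def by blast+
  have "\<iota> (f - f') = \<iota> f - \<iota> f'"
    using compl dom unfolding hilbert_completion_def minus by metis
  moreover have "op_apply A (f - f') = g - g'"
    using A mem unfolding op_apply_def linear_operator_def
    by (intro the_equality) (auto dest: single_valuedD)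
  moreover have "cinner (\<iota> (f - f')) (\<iota> (f - f')) = op_form A (f - f') (f - f')"
    using compl dom(4) unfolding hilbert_completion_def by blast
  ultimately show ?thesis
    by (simp add: dist_norm norm_eq_sqrt_inner inner_eq_Re_cinner op_form_def f f')
qed

theorem theorem3p8:
  fixes A :: "('a::complex_hilbert_space \<times> 'b::complex_hilbert_space) set"
    and \<iota> :: "'a \<Rightarrow> 'h::complex_hilbert_space"
    and A\<^sub>0 :: "('h \<times> 'b) set"
  assumes "separable_space (euclidean :: 'a topology)"
    and "separable_space (euclidean :: 'b topology)"
    and "linear_operator A"
    and "densely_defined A"
    and "closed A"
    and "op_kernel A = {0}"
    and "spectrum_inf (op_adjoint A \<circ>\<^sub>o A) = 0"
    and "hilbert_completion (Domain A) (op_form A) \<iota>"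
    and "A\<^sub>0 = transported_operator \<iota> A"
  shows "closure (op_adjoint A \<circ>\<^sub>o A\<^sub>0) = op_adjoint A \<circ>\<^sub>o closure A\<^sub>0"
proof
  have isometric: "dist x x' = dist g g'" if "(x, g) \<in> A\<^sub>0" "(x', g') \<in> A\<^sub>0" for x x' g g'
    using transported_operator_isometric[OF assms(3,8)] that assms(9) by metis
  show "closure (op_adjoint A \<circ>\<^sub>o A\<^sub>0) \<subseteq> op_adjoint A \<circ>\<^sub>o closure A\<^sub>0"
  proof
    fix p assume "p \<in> closure (op_adjoint A \<circ>\<^sub>o A\<^sub>0)"
    then obtain u where u: "\<And>n. u n \<in> op_adjoint A \<circ>\<^sub>o A\<^sub>0" "u \<longlonglongrightarrow> p"
      unfolding closure_sequential by blast
    have "\<exists>g. (fst (u n), g) \<in> A\<^sub>0 \<and> (g, snd (u n)) \<in> op_adjoint A" for n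
      using u(1)[of n] by (metis prod.collapse relcompEpair)
    then obtain g where g: "\<And>n. (fst (u n), g n) \<in> A\<^sub>0" "\<And>n. (g n, snd (u n)) \<in> op_adjoint A"
      by metis
    have lim: "(\<lambda>n. fst (u n)) \<longlonglongrightarrow> fst p" "(\<lambda>n. snd (u n)) \<longlonglongrightarrow> snd p"
      by (intro tendsto_fst tendsto_snd u(2))+
    have "Cauchy (\<lambda>n. fst (u n))" using lim(1) by (rule LIMSEQ_imp_Cauchy)
    \<comment> \<open>The isometry carries the Cauchy property from the first components to the
      intermediate values, which then converge by completeness.\<close>
    then have "Cauchy g" unfolding Cauchy_def by (simp add: isometric[OF g(1) g(1)])
    then obtain l where l: "g \<longlonglongrightarrow> l" using Cauchy_convergent convergent_def by blast
    have "(fst p, l) \<in> closure A\<^sub>0"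
      unfolding closure_sequential
      using g(1) tendsto_Pair[OF lim(1) l] by (intro exI[of _ "\<lambda>n. (fst (u n), g n)"]) simp
    moreover have "(l, snd p) \<in> op_adjoint A"
      using closed_sequentially[OF closed_op_adjoint[OF assms(3)] _ tendsto_Pair[OF l lim(2)]] g(2)
      by simp
    ultimately show "p \<in> op_adjoint A \<circ>\<^sub>o closure A\<^sub>0" by (metis prod.collapse relcompI)
  qed
  show "op_adjoint A \<circ>\<^sub>o closure A\<^sub>0 \<subseteq> closure (op_adjoint A \<circ>\<^sub>o A\<^sub>0)"
  proof clarify
    fix x g h assume xg: "(x, g) \<in> closure A\<^sub>0" and gh: "(g, h) \<in> op_adjoint A"
    have "g \<in> closure (Range A)"
      using closure_transported_operator_subset[of \<iota> A] xg assms(9) by blast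
    then have "(g, h) \<in> closure (op_adjoint A \<inter> Range A \<times> UNIV)"
      using closure_adjoint_range_core[OF assms(3,5)] gh by blast
    then obtain v where v: "\<And>n. v n \<in> op_adjoint A \<inter> Range A \<times> UNIV" "v \<longlonglongrightarrow> (g, h)"
      unfolding closure_sequential by blast
    have "\<exists>y. (y, fst (v n)) \<in> A\<^sub>0" for n
      using v(1)[of n] assms(9) unfolding transported_operator_def by fastforce
    \<comment> \<open>Lifting the approximants of \<open>g\<close> through \<open>A\<^sub>0\<close>
      gives points whose convergence to \<open>x\<close> is not yet known.\<close>
    then obtain y where y: "\<And>n. (y n, fst (v n)) \<in> A\<^sub>0" by metis
    \<comment> \<open>A reference sequence: the second components of \<open>v\<close>'s lifts and of
      \<open>w\<close> share the limit \<open>g\<close>, so by isometry \<open>y\<close> shares the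
      limit \<open>x\<close> of the first components of \<open>w\<close>.\<close>
    obtain w where w: "\<And>n. w n \<in> A\<^sub>0" "w \<longlonglongrightarrow> (x, g)"
      using xg unfolding closure_sequential by blast
    have lim: "(\<lambda>n. fst (w n)) \<longlonglongrightarrow> x" "(\<lambda>n. snd (w n)) \<longlonglongrightarrow> g"
      "(\<lambda>n. fst (v n)) \<longlonglongrightarrow> g" "(\<lambda>n. snd (v n)) \<longlonglongrightarrow> h"
      using tendsto_fst[OF w(2)] tendsto_snd[OF w(2)] tendsto_fst[OF v(2)] tendsto_snd[OF v(2)]
      by simp_all
    have "(\<lambda>n. dist (fst (v n)) (snd (w n))) \<longlonglongrightarrow> 0"
      using tendsto_dist[OF lim(3,2)] by simp
    moreover have "dist (y n) (fst (w n)) = dist (fst (v n)) (snd (w n))" for n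
      using isometric[OF y] w(1) by (metis prod.collapse)
    ultimately have "(\<lambda>n. dist (y n) (fst (w n))) \<longlonglongrightarrow> 0" by simp
    then have "(\<lambda>n. y n - fst (w n)) \<longlonglongrightarrow> 0" by (simp add: dist_norm tendsto_norm_zero_iff)
    then have "y \<longlonglongrightarrow> x" using tendsto_add[OF _ lim(1)] by fastforce
    moreover have "(y n, snd (v n)) \<in> op_adjoint A \<circ>\<^sub>o A\<^sub>0" for n
      using y v(1)[of n] by (metis IntD1 prod.collapse relcompI)
    ultimately show "(x, h) \<in> closure (op_adjoint A \<circ>\<^sub>o A\<^sub>0)"
      unfolding closure_sequential using tendsto_Pair[OF _ lim(4), of y x]
      by (intro exI[of _ "\<lambda>n. (y n, snd (v n))"]) simp
  qed
qed

end
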